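(* Let $\gamma_1(t)=e^{-\pi t^2}$ and $\gamma_2(t)=2\pi t\,e^{-\pi t^2}$ for $t\in\mathbb{R}$. Let $\varphi,\psi\in L^2(\mathbb{R})$ satisfy $|\mathcal{F}[\gamma_1\varphi](\xi)|=|\mathcal{F}[\gamma_1\psi](\xi)|$ and $|\mathcal{F}[\gamma_2\varphi](\xi)|=|\mathcal{F}[\gamma_2\psi](\xi)|$ for all $\xi\in\mathbb{R}$. Then there exists $c\in\mathbb{C}$ with $|c|=1$ such that either $\psi=c\varphi$ or $\psi=c\varphi^*$, where $\varphi^*(x)=\overline{\varphi(-x)}$.
   Context: The Fourier transform is normalized as $\mathcal{F}f(\xi)=\hat f(\xi)=\int_{\mathbb{R}}f(x)e^{-2\pi i x\xi}\,dx$ for $f\in L^1(\mathbb{R})$, extended to $L^2(\mathbb{R})$ in the usual way. Equalities of functions in $L^2$ are understood almost everywhere. *)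

theory Defs
  imports "HOL-Analysis.Analysis"
begin

text \<open>Square-integrable complex-valued functions on the real line (representatives of L^2 classes).\<close>
definition L2 :: "(real \<Rightarrow> complex) set" where
  "L2 = {f. f \<in> borel_measurable lborel \<and> integrable lborel (\<lambda>x. (cmod (f x))^2)}"

definition fourier :: "(real \<Rightarrow> complex) \<Rightarrow> real \<Rightarrow> complex" where
  "fourier f \<xi> = (LINT x|lborel. f x * cis (- 2 * pi * x * \<xi>))"

definition gamma1 :: "real \<Rightarrow> complex" where
  "gamma1 t = complex_of_real (exp (- pi * t^2))"

definition gamma2 :: "real \<Rightarrow> complex" where
  "gamma2 t = complex_of_real (2 * pi * t * exp (- pi * t^2))"

end

theory Submission
  imports Defs "HOL-Probability.Probability" "HOL-Complex_Analysis.Complex_Analysis"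
begin

text \<open>
  For \<open>f \<in> L2\<close> the integral \<open>T f z = \<integral> f t exp (- \<pi> t\<^sup>2 - 2 \<pi> \<i> t z) dt\<close> converges for every
  complex \<open>z\<close> and is entire. On the real line \<open>T f\<close> is the Fourier transform of \<open>\<gamma>\<^sub>1 f\<close> and
  \<open>\<i> (T f)'\<close> that of \<open>\<gamma>\<^sub>2 f\<close>, so for \<open>G = T \<phi>\<close> and \<open>H = T \<psi>\<close> the hypotheses say \<open>|H| = |G|\<close>
  and \<open>|H'| = |G'|\<close> on the reals. With \<open>F\<^sup>*(z) = cnj (F (cnj z))\<close> these become identities
  \<open>H H\<^sup>* = G G\<^sup>*\<close> and \<open>H' H'\<^sup>* = G' G'\<^sup>*\<close> between entire functions, which force \<open>H = c G\<close> or
  \<open>H = c G\<^sup>*\<close> with \<open>|c| = 1\<close>. As \<open>G\<^sup>*\<close> agrees on the reals with the transform of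
  \<open>\<phi>\<^sup>*(x) = cnj (\<phi> (- x))\<close>, injectivity of the Fourier transform on \<open>L\<^sup>1\<close>, which follows from
  Levy's uniqueness theorem for characteristic functions, gives \<open>\<psi> = c \<phi>\<close> or \<open>\<psi> = c \<phi>\<^sup>*\<close>
  almost everywhere.
\<close>

section \<open>Entire functions determined by their modulus and that of their derivative\<close>

lemma zero_islimpt_range_of_real: "(0::complex) islimpt range complex_of_real"
proof -
  have "(\<lambda>n. complex_of_real (inverse (real (Suc n)))) \<longlonglongrightarrow> 0"
    using tendsto_of_real[OF LIMSEQ_inverse_real_of_nat, where 'a=complex] by simp
  moreover have "complex_of_real (inverse (real (Suc n))) \<in> range complex_of_real - {0}" for n
    by (simp del: of_real_inverse of_real_of_nat_eq)
  ultimately show ?thesis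
    unfolding islimpt_sequential by (intro exI[of _ "\<lambda>n. complex_of_real (inverse (real (Suc n)))"]) simp
qed

lemma entire_eq_0_if_eq_0_on_reals:
  assumes "G holomorphic_on UNIV" and "\<And>x::real. G (complex_of_real x) = 0"
  shows "G z = 0"
  using analytic_continuation[OF assms(1) open_UNIV connected_UNIV subset_UNIV UNIV_I zero_islimpt_range_of_real]
    assms(2) by auto

lemma entire_eq_0_if_eq_0_near:
  assumes "G holomorphic_on UNIV" and "e > 0" and "\<And>z. z \<in> ball z0 e \<Longrightarrow> G z = 0"
  shows "G z = 0"
  using analytic_continuation[of G UNIV "ball z0 e" z0] assms by (simp add: islimpt_ball connected_UNIV)

lemma entire_nonzero_near:
  assumes "G holomorphic_on UNIV" and "G z0 \<noteq> 0"
  obtains e where "e > 0" and "\<And>z. z \<in> ball z0 e \<Longrightarrow> G z \<noteq> 0"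
proof -
  have "continuous_on UNIV G"
    using assms(1) by (rule holomorphic_on_imp_continuous_on)
  then have "isCont G z0" by (simp add: continuous_on_eq_continuous_at)
  from continuous_at_avoid[OF this assms(2)] show ?thesis
    using that by (auto simp: dist_commute)
qed

lemma entire_mult_eq_0_cases:
  assumes f: "f holomorphic_on UNIV" and g: "g holomorphic_on UNIV"
    and fg: "\<And>z. f z * g z = 0"
  shows "(\<forall>z. f z = 0) \<or> (\<forall>z. g z = 0)"
proof (cases "\<forall>z. g z = 0")
  case False
  then obtain z0 where "g z0 \<noteq> 0" by auto
  then obtain e where "e > 0" and "\<And>z. z \<in> ball z0 e \<Longrightarrow> g z \<noteq> 0"
    using entire_nonzero_near[OF g] by blast
  then have "\<And>z. z \<in> ball z0 e \<Longrightarrow> f z = 0"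
    using fg by (metis mult_eq_0_iff)
  then show ?thesis
    using entire_eq_0_if_eq_0_near[OF f \<open>e > 0\<close>] by blast
qed auto

lemma entire_has_field_derivative:
  "G holomorphic_on UNIV \<Longrightarrow> (G has_field_derivative deriv G z) (at z)"
  using holomorphic_derivI open_UNIV by blast

lemma entire_deriv_holomorphic:
  "G holomorphic_on UNIV \<Longrightarrow> deriv G holomorphic_on UNIV"
  using holomorphic_deriv open_UNIV by blast

lemma entire_reflect_holomorphic:
  assumes "G holomorphic_on UNIV"
  shows "(\<lambda>z. cnj (G (cnj z))) holomorphic_on UNIV"
proof -
  have "cnj \<circ> G \<circ> cnj holomorphic_on UNIV"
    by (rule holomorphic_on_compose_cnj_cnj) (use assms in auto)
  then show ?thesis by (simp add: o_def)
qed

lemma entire_reflect_has_field_derivative: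
  assumes "G holomorphic_on UNIV"
  shows "((\<lambda>z. cnj (G (cnj z))) has_field_derivative cnj (deriv G (cnj z))) (at z)"
  using has_field_derivative_cnj_cnj[OF entire_has_field_derivative[OF assms, of "cnj z"]]
  by (simp add: o_def)

lemma deriv_entire_reflect:
  "G holomorphic_on UNIV \<Longrightarrow> deriv (\<lambda>z. cnj (G (cnj z))) z = cnj (deriv G (cnj z))"
  using DERIV_imp_deriv[OF entire_reflect_has_field_derivative] .

lemma entire_mult_reflect_eq_if_norm_eq_on_reals:
  assumes G: "G holomorphic_on UNIV" and H: "H holomorphic_on UNIV"
    and "\<And>x::real. cmod (G x) = cmod (H x)"
  shows "H z * cnj (H (cnj z)) = G z * cnj (G (cnj z))"
proof -
  define F where "F z = H z * cnj (H (cnj z)) - G z * cnj (G (cnj z))" for z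
  have "F holomorphic_on UNIV"
    unfolding F_def by (intro holomorphic_intros entire_reflect_holomorphic G H)
  moreover have "F x = 0" for x :: real
    using assms(3)[of x] by (simp add: F_def complex_norm_square[symmetric])
  ultimately have "F z = 0" by (rule entire_eq_0_if_eq_0_on_reals)
  then show ?thesis by (simp add: F_def)
qed

text \<open>A vanishing Wronskian makes \<open>H / G\<close> locally constant near a point where \<open>G \<noteq> 0\<close>;
  the identity theorem then propagates \<open>H = c G\<close> to the whole plane.\<close>
lemma entire_proportional_if_wronskian_eq_0:
  assumes G: "G holomorphic_on UNIV" and H: "H holomorphic_on UNIV"
    and Gz0: "G z0 \<noteq> 0" and W: "\<And>z. deriv H z * G z = deriv G z * H z"
  shows "H z = H z0 / G z0 * G z"
proof -
  define c where "c = H z0 / G z0"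
  define K where "K z = H z - c * G z" for z
  obtain e where e: "e > 0" "\<And>z. z \<in> ball z0 e \<Longrightarrow> G z \<noteq> 0"
    using entire_nonzero_near[OF G Gz0] by blast
  have "((\<lambda>z. K z / G z) has_field_derivative 0) (at z within ball z0 e)"
    if "z \<in> ball z0 e" for z
  proof -
    have dK: "(K has_field_derivative deriv H z - c * deriv G z) (at z)" unfolding K_def
      by (intro DERIV_diff DERIV_cmult entire_has_field_derivative G H)
    have "((deriv H z - c * deriv G z) * G z - K z * deriv G z) = 0"
      using W[of z] by (simp add: K_def algebra_simps)
    then show ?thesis
      using DERIV_divide[OF dK entire_has_field_derivative[OF G] e(2)[OF that]]
      by (auto intro: has_field_derivative_at_within)
  qed
  from has_field_derivative_zero_constant[OF convex_ball this]
  obtain k where k: "\<And>z. z \<in> ball z0 e \<Longrightarrow> K z / G z = k" by blast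
  have "k = 0" using k[of z0] e(1) by (simp add: K_def c_def Gz0)
  then have "\<And>z. z \<in> ball z0 e \<Longrightarrow> K z = 0"
    using k e(2) by (metis divide_eq_0_iff)
  moreover have "K holomorphic_on UNIV" unfolding K_def by (intro holomorphic_intros G H)
  ultimately have "K z = 0" using entire_eq_0_if_eq_0_near e(1) by blast
  then show ?thesis by (simp add: K_def c_def)
qed

lemma entire_eq_unimodular_mult:
  assumes G: "G holomorphic_on UNIV" and H: "H holomorphic_on UNIV"
    and P: "\<And>z. H z * cnj (H (cnj z)) = G z * cnj (G (cnj z))"
    and D: "\<And>z. deriv H z * cnj (H (cnj z)) = deriv G z * cnj (G (cnj z))"
  shows "\<exists>c. cmod c = 1 \<and> (\<forall>z. H z = c * G z)"
proof (cases "\<forall>z. G z = 0")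
  case True
  have "H z = 0" for z
  proof (rule entire_eq_0_if_eq_0_on_reals[OF H])
    fix x :: real
    show "H x = 0" using P[of x] True by simp
  qed
  then show ?thesis using True by (intro exI[of _ 1]) auto
next
  case False
  then obtain x0 :: real where Gx0: "G x0 \<noteq> 0"
    using entire_eq_0_if_eq_0_on_reals[OF G] by blast
  have "H x0 * cnj (H x0) = G x0 * cnj (G x0)" using P[of x0] by simp
  then have "complex_of_real (cmod (H x0) ^ 2) = complex_of_real (cmod (G x0) ^ 2)"
    by (simp only: complex_norm_square)
  then have norm_eq: "cmod (H x0) = cmod (G x0)"
    by (simp only: of_real_eq_iff power2_eq_iff_nonneg norm_ge_zero)
  have W: "(\<lambda>z. deriv H z * G z - deriv G z * H z) holomorphic_on UNIV"
    and R: "(\<lambda>z. cnj (G (cnj z)) * cnj (H (cnj z))) holomorphic_on UNIV"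
    by (intro holomorphic_intros entire_deriv_holomorphic entire_reflect_holomorphic G H)+
  have "(deriv H z * G z - deriv G z * H z) * (cnj (G (cnj z)) * cnj (H (cnj z))) = 0" for z
  proof -
    have "(deriv H z * G z - deriv G z * H z) * (cnj (G (cnj z)) * cnj (H (cnj z)))
        = (deriv H z * cnj (H (cnj z))) * (G z * cnj (G (cnj z)))
          - (deriv G z * cnj (G (cnj z))) * (H z * cnj (H (cnj z)))"
      by (simp add: algebra_simps)
    also have "\<dots> = 0" by (simp only: P D diff_self)
    finally show ?thesis .
  qed
  from entire_mult_eq_0_cases[OF W R this]
  have "\<forall>z. deriv H z * G z - deriv G z * H z = 0"
  proof
    assume "\<forall>z. cnj (G (cnj z)) * cnj (H (cnj z)) = 0"
    then have "cnj (G (cnj x0)) * cnj (H (cnj x0)) = 0" by (rule spec)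
    moreover have "H x0 \<noteq> 0" using Gx0 norm_eq by (metis norm_eq_zero)
    ultimately show ?thesis using Gx0 by simp
  qed
  then have "H z = H x0 / G x0 * G z" for z
    by (intro entire_proportional_if_wronskian_eq_0[OF G H Gx0]) simp
  moreover have "cmod (H x0 / G x0) = 1"
    using norm_eq Gx0 by (simp add: norm_divide)
  ultimately show ?thesis by blast
qed

text \<open>From \<open>H H\<^sup>* = G G\<^sup>*\<close> and \<open>H' H'\<^sup>* = G' G'\<^sup>*\<close> (with \<open>F\<^sup>*(z) = cnj (F (cnj z))\<close>), the
  numbers \<open>H' H\<^sup>*\<close> and \<open>H H'\<^sup>*\<close> have the same sum (the derivative of \<open>H H\<^sup>*\<close>) and the same
  product as \<open>G' G\<^sup>*\<close> and \<open>G G'\<^sup>*\<close>, so \<open>H' H\<^sup>*\<close> agrees with one of these two; by the identity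
  theorem it does so everywhere.\<close>
lemma entire_phase_retrieval:
  assumes G: "G holomorphic_on UNIV" and H: "H holomorphic_on UNIV"
    and norm_eq: "\<And>x::real. cmod (G x) = cmod (H x)"
    and deriv_norm_eq: "\<And>x::real. cmod (deriv G x) = cmod (deriv H x)"
  shows "\<exists>c. cmod c = 1 \<and> ((\<forall>z. H z = c * G z) \<or> (\<forall>z. H z = c * cnj (G (cnj z))))"
proof -
  have P: "\<And>z. H z * cnj (H (cnj z)) = G z * cnj (G (cnj z))"
    by (rule entire_mult_reflect_eq_if_norm_eq_on_reals[OF G H norm_eq])
  have Q: "\<And>z. deriv H z * cnj (deriv H (cnj z)) = deriv G z * cnj (deriv G (cnj z))"
    by (rule entire_mult_reflect_eq_if_norm_eq_on_reals[OF entire_deriv_holomorphic[OF G]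
          entire_deriv_holomorphic[OF H] deriv_norm_eq])
  have product_rule: "((\<lambda>z. F z * cnj (F (cnj z))) has_field_derivative
      deriv F z * cnj (F (cnj z)) + F z * cnj (deriv F (cnj z))) (at z)"
    if "F holomorphic_on UNIV" for F z
    using DERIV_mult[OF entire_has_field_derivative[OF that] entire_reflect_has_field_derivative[OF that]]
    by (simp add: mult.commute)
  have S: "deriv H z * cnj (H (cnj z)) + H z * cnj (deriv H (cnj z))
         = deriv G z * cnj (G (cnj z)) + G z * cnj (deriv G (cnj z))" for z
  proof -
    have "(\<lambda>z. H z * cnj (H (cnj z))) = (\<lambda>z. G z * cnj (G (cnj z)))" using P by auto
    then show ?thesis using DERIV_unique[OF product_rule[OF H, of z]] product_rule[OF G, of z] by metis
  qed
  define a where "a z = deriv G z * cnj (G (cnj z))" for z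
  define b where "b z = G z * cnj (deriv G (cnj z))" for z
  define e where "e z = deriv H z * cnj (H (cnj z))" for z
  have "(e z - a z) * (e z - b z) = 0" for z
  proof -
    have ab: "a z * b z = (G z * cnj (G (cnj z))) * (deriv G z * cnj (deriv G (cnj z)))"
      by (simp add: a_def b_def algebra_simps)
    have ed: "e z * (H z * cnj (deriv H (cnj z)))
        = (H z * cnj (H (cnj z))) * (deriv H z * cnj (deriv H (cnj z)))"
      by (simp add: e_def algebra_simps)
    have "(e z - a z) * (e z - b z) = e z * e z - (a z + b z) * e z + a z * b z"
      by (simp add: algebra_simps)
    also have "a z + b z = e z + H z * cnj (deriv H (cnj z))"
      using S[of z] by (simp add: a_def b_def e_def)
    also have "a z * b z = e z * (H z * cnj (deriv H (cnj z)))"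
      using ab ed P[of z] Q[of z] by simp
    finally show ?thesis by (simp add: algebra_simps)
  qed
  moreover have "(\<lambda>z. e z - a z) holomorphic_on UNIV" "(\<lambda>z. e z - b z) holomorphic_on UNIV"
    unfolding a_def b_def e_def
    by (intro holomorphic_intros entire_reflect_holomorphic entire_deriv_holomorphic G H)+
  ultimately have "(\<forall>z. e z - a z = 0) \<or> (\<forall>z. e z - b z = 0)"
    using entire_mult_eq_0_cases by blast
  then show ?thesis
  proof
    assume "\<forall>z. e z - a z = 0"
    then have "\<And>z. deriv H z * cnj (H (cnj z)) = deriv G z * cnj (G (cnj z))"
      by (simp add: a_def e_def)
    from entire_eq_unimodular_mult[OF G H P this] show ?thesis by blast
  next
    assume eb: "\<forall>z. e z - b z = 0"
    define G_refl where "G_refl z = cnj (G (cnj z))" for z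
    have G_refl: "G_refl holomorphic_on UNIV" unfolding G_refl_def by (rule entire_reflect_holomorphic[OF G])
    have "H z * cnj (H (cnj z)) = G_refl z * cnj (G_refl (cnj z))" for z
      using P by (simp add: G_refl_def mult.commute)
    moreover have "deriv H z * cnj (H (cnj z)) = deriv G_refl z * cnj (G_refl (cnj z))" for z
      using eb unfolding G_refl_def deriv_entire_reflect[OF G] by (simp add: b_def e_def mult.commute)
    ultimately show ?thesis
      using entire_eq_unimodular_mult[OF G_refl H] by (auto simp: G_refl_def)
  qed
qed

section \<open>An entire transform of square-integrable functions\<close>

lemma norm_exp_minus_1_minus_le:
  fixes z :: complex
  shows "norm (exp z - 1 - z) \<le> norm z ^ 2 * exp (norm z)"
proof (cases "z = 0")
  case False
  have sums: "(\<lambda>k. z ^ (k + 2) /\<^sub>R fact (k + 2)) sums (exp z - (\<Sum>k<2. z ^ k /\<^sub>R fact k))"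
    by (intro sums_split_initial_segment exp_converges)
  have "summable (\<lambda>k. norm z ^ (k + 2) /\<^sub>R fact (k + 2))"
    using summable_norm_exp[of z]
    by (intro summable_norm summable_ignore_initial_segment)
       (auto simp: norm_power norm_divide divide_simps)
  also have "?this \<longleftrightarrow> summable (\<lambda>k. norm z ^ 2 * (norm z ^ k / fact (k + 2)))"
    by (simp add: power_add mult_ac divide_simps power2_eq_square del: of_nat_Suc of_nat_add)
  also have "\<dots> \<longleftrightarrow> summable (\<lambda>k. norm z ^ k / fact (k + 2))"
    by (subst summable_cmult_iff) (use \<open>z \<noteq> 0\<close> in auto)
  finally have summable: "summable (\<lambda>k. norm z ^ k / fact (k + 2))" .
  have "exp z - 1 - z = (\<Sum>k. z ^ (k + 2) / fact (k + 2))"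
    using sums by (simp add: sums_iff scaleR_conv_of_real divide_simps eval_nat_numeral)
  also have "norm \<dots> \<le> (\<Sum>k. norm (z ^ (k + 2) / fact (k + 2)))"
    using summable_norm_exp[of z]
    by (intro summable_norm summable_ignore_initial_segment)
       (auto simp: norm_power norm_divide divide_simps)
  also have "\<dots> = (\<Sum>k. norm z ^ 2 * (norm z ^ k / fact (k + 2)))"
    by (simp add: power_add norm_power norm_divide mult_ac norm_mult power2_eq_square del: of_nat_Suc)
  also have "\<dots> = norm z ^ 2 * (\<Sum>k. norm z ^ k / fact (k + 2))"
    using summable by (rule suminf_mult)
  also have "\<dots> \<le> norm z ^ 2 * exp (norm z)"
  proof (intro mult_left_mono, rule sums_le)
    show "(\<lambda>k. norm z ^ k / fact (k + 2)) sums (\<Sum>k. norm z ^ k / fact (k + 2))"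
      using summable by blast
    show "(\<lambda>k. norm z ^ k / fact k) sums exp (norm z)"
      using exp_converges[of "norm z"] by (simp add: divide_inverse mult.commute)
  next
    fix k :: nat
    show "norm z ^ k / fact (k + 2) \<le> norm z ^ k / fact k"
      by (intro divide_left_mono fact_mono) auto
  qed auto
  finally show ?thesis .
qed auto

lemma abs_le_1_plus_square: "\<bar>t::real\<bar> \<le> 1 + t\<^sup>2"
proof -
  have "0 \<le> (\<bar>t\<bar> - 1/2)\<^sup>2 + 3/4" by simp
  then show ?thesis by (simp add: power2_eq_square algebra_simps)
qed

text \<open>\<open>R \<bar>t\<bar>\<close> absorbs \<open>|exp (- 2 \<pi> \<i> t z)| = exp (2 \<pi> t Im z)\<close> for \<open>2 \<pi> |Im z| \<le> R\<close>, and the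
  factor \<open>1 + t\<^sup>2\<close> absorbs the extra powers of \<open>t\<close> in the moment transform and in the derivative.\<close>
definition gauss_majorant :: "real \<Rightarrow> real \<Rightarrow> real" where
  "gauss_majorant R t = (1 + t\<^sup>2) * exp (- pi * t\<^sup>2 + R * \<bar>t\<bar>)"

lemma gauss_majorant_nonneg: "gauss_majorant R t \<ge> 0"
  by (simp add: gauss_majorant_def)

lemma gauss_majorant_measurable[measurable]: "gauss_majorant R \<in> borel_measurable borel"
  unfolding gauss_majorant_def by measurable

text \<open>Bounded by \<open>(1 + t\<^sup>2)\<^sup>2\<close> times a multiple of the standard normal density, whose moments
  of order 0, 2 and 4 are finite.\<close>
lemma gauss_majorant_square_integrable:
  "integrable lborel (\<lambda>t. (gauss_majorant R t)\<^sup>2)"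
proof -
  let ?g = "\<lambda>t. exp (R\<^sup>2) * sqrt (2 * pi) *
      (std_normal_density t + 2 * (std_normal_density t * t ^ 2) + std_normal_density t * t ^ 4)"
  have "integrable lborel ?g"
    using integrable_std_normal_moment[of 0] integrable_std_normal_moment[of 2]
      integrable_std_normal_moment[of 4]
    by (intro Bochner_Integration.integrable_mult_right Bochner_Integration.integrable_add) auto
  then show ?thesis
  proof (rule Bochner_Integration.integrable_bound)
    show "(\<lambda>t. (gauss_majorant R t)\<^sup>2) \<in> borel_measurable lborel" by measurable
    show "AE t in lborel. norm ((gauss_majorant R t)\<^sup>2) \<le> norm (?g t)"
    proof (rule AE_I2)
      fix t :: real
      have exponent: "- 2 * pi * t\<^sup>2 + 2 * R * \<bar>t\<bar> \<le> R\<^sup>2 + (- t\<^sup>2 / 2)"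
      proof -
        have "0 \<le> (R - \<bar>t\<bar>)\<^sup>2 + (2 * pi - 3/2) * t\<^sup>2"
          using pi_gt3 by (intro add_nonneg_nonneg) auto
        also have "(R - \<bar>t\<bar>)\<^sup>2 = R\<^sup>2 - 2 * R * \<bar>t\<bar> + t\<^sup>2"
          by (simp add: power2_eq_square algebra_simps)
        finally show ?thesis by (simp add: algebra_simps)
      qed
      have "(gauss_majorant R t)\<^sup>2 = (1 + t\<^sup>2)\<^sup>2 * exp (- 2 * pi * t\<^sup>2 + 2 * R * \<bar>t\<bar>)"
        by (simp add: gauss_majorant_def power_mult_distrib exp_double[symmetric] algebra_simps
            power2_eq_square flip: exp_add)
      also have "\<dots> \<le> (1 + t\<^sup>2)\<^sup>2 * (exp (R\<^sup>2) * exp (- t\<^sup>2 / 2))"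
        using exponent by (intro mult_left_mono) (auto simp flip: exp_add)
      also have "\<dots> = ?g t"
        by (simp add: std_normal_density_def power2_eq_square algebra_simps power4_eq_xxxx)
      finally show "norm ((gauss_majorant R t)\<^sup>2) \<le> norm (?g t)" by simp
    qed
  qed
qed

lemma L2_mult_gauss_majorant_integrable:
  assumes f: "f \<in> L2"
  shows "integrable lborel (\<lambda>t. cmod (f t) * gauss_majorant R t)"
proof -
  have fm: "f \<in> borel_measurable lborel" and fi: "integrable lborel (\<lambda>x. (cmod (f x))\<^sup>2)"
    using f by (auto simp: L2_def)
  have "integrable lborel (\<lambda>t. (cmod (f t))\<^sup>2 + (gauss_majorant R t)\<^sup>2)"
    by (intro Bochner_Integration.integrable_add fi gauss_majorant_square_integrable)
  then show ?thesis
  proof (rule Bochner_Integration.integrable_bound)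
    show "(\<lambda>t. cmod (f t) * gauss_majorant R t) \<in> borel_measurable lborel"
      using fm by measurable
    show "AE t in lborel. norm (cmod (f t) * gauss_majorant R t)
        \<le> norm ((cmod (f t))\<^sup>2 + (gauss_majorant R t)\<^sup>2)"
    proof (rule AE_I2)
      fix t
      have "2 * cmod (f t) * gauss_majorant R t \<le> (cmod (f t))\<^sup>2 + (gauss_majorant R t)\<^sup>2"
        by (rule sum_squares_bound)
      moreover have "0 \<le> cmod (f t) * gauss_majorant R t"
        using gauss_majorant_nonneg[of R t] by simp
      ultimately show "norm (cmod (f t) * gauss_majorant R t)
          \<le> norm ((cmod (f t))\<^sup>2 + (gauss_majorant R t)\<^sup>2)"
        by simp
    qed
  qed
qed

definition gauss_kernel :: "complex \<Rightarrow> real \<Rightarrow> complex" where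
  "gauss_kernel z t =
    exp (- complex_of_real (pi * t\<^sup>2) - 2 * complex_of_real pi * \<i> * complex_of_real t * z)"

definition gauss_transform :: "(real \<Rightarrow> complex) \<Rightarrow> complex \<Rightarrow> complex" where
  "gauss_transform f z = (LINT t|lborel. f t * gauss_kernel z t)"

definition gauss_moment_transform :: "(real \<Rightarrow> complex) \<Rightarrow> complex \<Rightarrow> complex" where
  "gauss_moment_transform f z = (LINT t|lborel. complex_of_real t * f t * gauss_kernel z t)"

lemma gauss_kernel_measurable[measurable]: "gauss_kernel z \<in> borel_measurable borel"
  unfolding gauss_kernel_def by (intro borel_measurable_continuous_onI continuous_intros)

lemma gauss_kernel_add:
  "gauss_kernel (z + h) t = gauss_kernel z t * exp (- 2 * complex_of_real pi * \<i> * complex_of_real t * h)"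
  by (simp add: gauss_kernel_def algebra_simps flip: exp_add)

lemma norm_gauss_kernel_le:
  "cmod (gauss_kernel z t) \<le> exp (- pi * t\<^sup>2 + 2 * pi * \<bar>Im z\<bar> * \<bar>t\<bar>)"
proof -
  have "t * Im z \<le> \<bar>Im z\<bar> * \<bar>t\<bar>"
    by (metis abs_ge_self abs_mult mult.commute)
  then have "- pi * t\<^sup>2 + 2 * pi * t * Im z \<le> - pi * t\<^sup>2 + 2 * pi * \<bar>Im z\<bar> * \<bar>t\<bar>"
    by (simp add: mult.assoc)
  then show ?thesis
    by (simp add: gauss_kernel_def norm_exp_eq_Re)
qed

lemma norm_gauss_kernel_le_majorant:
  assumes "R \<ge> 2 * pi * \<bar>Im z\<bar>"
  shows "cmod (gauss_kernel z t) * (1 + t\<^sup>2) \<le> gauss_majorant R t"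
proof -
  have "2 * pi * \<bar>Im z\<bar> * \<bar>t\<bar> \<le> R * \<bar>t\<bar>"
    using assms by (simp add: mult_right_mono)
  then have "exp (- pi * t\<^sup>2 + 2 * pi * \<bar>Im z\<bar> * \<bar>t\<bar>) \<le> exp (- pi * t\<^sup>2 + R * \<bar>t\<bar>)"
    by simp
  with norm_gauss_kernel_le[of z t]
  have "cmod (gauss_kernel z t) \<le> exp (- pi * t\<^sup>2 + R * \<bar>t\<bar>)"
    by (rule order_trans)
  from mult_right_mono[OF this, of "1 + t\<^sup>2"] show ?thesis
    by (simp add: gauss_majorant_def mult.commute)
qed

lemma gauss_transform_integrable:
  assumes f: "f \<in> L2"
  shows "integrable lborel (\<lambda>t. f t * gauss_kernel z t)"
    and "integrable lborel (\<lambda>t. complex_of_real t * f t * gauss_kernel z t)"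
proof -
  let ?R = "2 * pi * \<bar>Im z\<bar>"
  have fm: "f \<in> borel_measurable lborel" using f by (simp add: L2_def)
  have Ii: "integrable lborel (\<lambda>t. cmod (f t) * gauss_majorant ?R t)"
    by (rule L2_mult_gauss_majorant_integrable[OF f])
  have bound: "cmod (gauss_kernel z t) * (1 + t\<^sup>2) \<le> gauss_majorant ?R t" for t
    by (rule norm_gauss_kernel_le_majorant) simp
  show "integrable lborel (\<lambda>t. f t * gauss_kernel z t)"
  proof (rule Bochner_Integration.integrable_bound[OF Ii])
    show "(\<lambda>t. f t * gauss_kernel z t) \<in> borel_measurable lborel" using fm by measurable
    show "AE t in lborel. norm (f t * gauss_kernel z t) \<le> norm (cmod (f t) * gauss_majorant ?R t)"
    proof (rule AE_I2)
      fix t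
      have "cmod (gauss_kernel z t) \<le> cmod (gauss_kernel z t) * (1 + t\<^sup>2)"
        by (simp add: mult_le_cancel_left1)
      then have "cmod (gauss_kernel z t) \<le> gauss_majorant ?R t" using bound[of t] by linarith
      then show "norm (f t * gauss_kernel z t) \<le> norm (cmod (f t) * gauss_majorant ?R t)"
        using gauss_majorant_nonneg[of ?R t] by (simp add: norm_mult mult_left_mono)
    qed
  qed
  show "integrable lborel (\<lambda>t. complex_of_real t * f t * gauss_kernel z t)"
  proof (rule Bochner_Integration.integrable_bound[OF Ii])
    show "(\<lambda>t. complex_of_real t * f t * gauss_kernel z t) \<in> borel_measurable lborel"
      using fm by measurable
    show "AE t in lborel. norm (complex_of_real t * f t * gauss_kernel z t)
        \<le> norm (cmod (f t) * gauss_majorant ?R t)"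
    proof (rule AE_I2)
      fix t
      have "\<bar>t\<bar> * cmod (gauss_kernel z t) \<le> cmod (gauss_kernel z t) * (1 + t\<^sup>2)"
        using mult_right_mono[OF abs_le_1_plus_square[of t], of "cmod (gauss_kernel z t)"]
        by (simp add: mult.commute)
      then have "\<bar>t\<bar> * cmod (gauss_kernel z t) \<le> gauss_majorant ?R t"
        using bound[of t] by linarith
      then have "cmod (f t) * (\<bar>t\<bar> * cmod (gauss_kernel z t)) \<le> cmod (f t) * gauss_majorant ?R t"
        by (simp add: mult_left_mono)
      then show "norm (complex_of_real t * f t * gauss_kernel z t)
          \<le> norm (cmod (f t) * gauss_majorant ?R t)"
        using gauss_majorant_nonneg[of ?R t] by (simp add: norm_mult mult_ac)
    qed
  qed
qed

lemma gauss_kernel_remainder_le_majorant: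
  "cmod (gauss_kernel z t) * (t\<^sup>2 * exp (2 * pi * \<bar>t\<bar>))
     \<le> gauss_majorant (2 * pi * \<bar>Im z\<bar> + 2 * pi) t"
proof -
  have "exp (- pi * t\<^sup>2 + 2 * pi * \<bar>Im z\<bar> * \<bar>t\<bar>) * exp (2 * pi * \<bar>t\<bar>)
      = exp (- pi * t\<^sup>2 + (2 * pi * \<bar>Im z\<bar> + 2 * pi) * \<bar>t\<bar>)"
    by (simp add: algebra_simps flip: exp_add)
  then have kernel: "cmod (gauss_kernel z t) * exp (2 * pi * \<bar>t\<bar>)
      \<le> exp (- pi * t\<^sup>2 + (2 * pi * \<bar>Im z\<bar> + 2 * pi) * \<bar>t\<bar>)"
    using mult_right_mono[OF norm_gauss_kernel_le[of z t], of "exp (2 * pi * \<bar>t\<bar>)"] by simp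
  have "t\<^sup>2 * (cmod (gauss_kernel z t) * exp (2 * pi * \<bar>t\<bar>))
      \<le> (1 + t\<^sup>2) * exp (- pi * t\<^sup>2 + (2 * pi * \<bar>Im z\<bar> + 2 * pi) * \<bar>t\<bar>)"
    by (rule mult_mono[OF _ kernel]) auto
  then show ?thesis by (simp add: gauss_majorant_def mult_ac)
qed


lemma gauss_transform_difference_quotient_bound:
  assumes f: "f \<in> L2" and "y \<noteq> z" and "norm (y - z) \<le> 1"
  shows "norm ((gauss_transform f y - gauss_transform f z) / (y - z)
            - (- 2 * complex_of_real pi * \<i>) * gauss_moment_transform f z)
         \<le> 4 * pi\<^sup>2 * (LINT t|lborel. cmod (f t) * gauss_majorant (2 * pi * \<bar>Im z\<bar> + 2 * pi) t)
            * norm (y - z)"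
proof -
  define R where "R = 2 * pi * \<bar>Im z\<bar> + 2 * pi"
  define h where "h = y - z"
  have h0: "h \<noteq> 0" and h1: "norm h \<le> 1" using assms by (auto simp: h_def)
  define w where "w t = - 2 * complex_of_real pi * \<i> * complex_of_real t * h" for t
  define F where "F t = (f t * gauss_kernel y t - f t * gauss_kernel z t) / h
      - (- 2 * complex_of_real pi * \<i>) * (complex_of_real t * f t * gauss_kernel z t)" for t
  note I = gauss_transform_integrable[OF f]
  have "integrable lborel F"
    unfolding F_def using I(1)[of y] I(1)[of z] I(2)[of z] by auto
  have quotient_eq: "(gauss_transform f y - gauss_transform f z) / (y - z)
      - (- 2 * complex_of_real pi * \<i>) * gauss_moment_transform f z = (LINT t|lborel. F t)"
    unfolding F_def gauss_transform_def gauss_moment_transform_def h_def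
    using I(1)[of y] I(1)[of z] I(2)[of z] by simp
  have F_bound: "norm (F t) \<le> 4 * pi\<^sup>2 * norm h * (cmod (f t) * gauss_majorant R t)" for t
  proof -
    have F_eq: "F t = f t * gauss_kernel z t * ((exp (w t) - 1 - w t) / h)"
      using gauss_kernel_add[of z h t] h0 by (simp add: F_def h_def w_def field_simps)
    have norm_w: "norm (w t) = 2 * pi * \<bar>t\<bar> * norm h"
      by (simp add: w_def norm_mult)
    have "norm (exp (w t) - 1 - w t) \<le> norm (w t) ^ 2 * exp (norm (w t))"
      by (rule norm_exp_minus_1_minus_le)
    also have "\<dots> \<le> norm (w t) ^ 2 * exp (2 * pi * \<bar>t\<bar>)"
      using h1 unfolding norm_w
      by (intro mult_left_mono) (auto intro!: mult_left_le simp: mult.assoc)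
    also have "\<dots> = 4 * pi\<^sup>2 * norm h ^ 2 * (t\<^sup>2 * exp (2 * pi * \<bar>t\<bar>))"
      unfolding norm_w by (simp add: power_mult_distrib power2_abs)
    finally have remainder: "norm (exp (w t) - 1 - w t) / norm h
        \<le> 4 * pi\<^sup>2 * norm h * (t\<^sup>2 * exp (2 * pi * \<bar>t\<bar>))"
      using h0 by (simp add: divide_le_eq power2_eq_square mult_ac)
    have "norm (F t)
        = cmod (f t) * (cmod (gauss_kernel z t) * (norm (exp (w t) - 1 - w t) / norm h))"
      by (simp add: F_eq norm_mult norm_divide)
    also have "\<dots> \<le> cmod (f t) * (cmod (gauss_kernel z t)
        * (4 * pi\<^sup>2 * norm h * (t\<^sup>2 * exp (2 * pi * \<bar>t\<bar>))))"
      by (intro mult_left_mono remainder) auto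
    also have "\<dots> = 4 * pi\<^sup>2 * norm h
        * (cmod (f t) * (cmod (gauss_kernel z t) * (t\<^sup>2 * exp (2 * pi * \<bar>t\<bar>))))"
      by (simp add: mult_ac)
    also have "\<dots> \<le> 4 * pi\<^sup>2 * norm h * (cmod (f t) * gauss_majorant R t)"
      unfolding R_def by (intro mult_left_mono gauss_kernel_remainder_le_majorant) auto
    finally show ?thesis .
  qed
  have "norm (LINT t|lborel. F t) \<le> (LINT t|lborel. norm (F t))"
    by (rule integral_norm_bound)
  also have "\<dots> \<le> (LINT t|lborel. 4 * pi\<^sup>2 * norm h * (cmod (f t) * gauss_majorant R t))"
    using \<open>integrable lborel F\<close> L2_mult_gauss_majorant_integrable[OF f] F_bound
    by (intro integral_mono) auto
  also have "\<dots> = 4 * pi\<^sup>2 * (LINT t|lborel. cmod (f t) * gauss_majorant R t) * norm h"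
    by (simp only: integral_mult_right_zero) (simp add: mult_ac)
  finally show ?thesis
    using quotient_eq by (simp add: R_def h_def)
qed

lemma gauss_transform_has_field_derivative:
  assumes f: "f \<in> L2"
  shows "(gauss_transform f has_field_derivative
          (- 2 * complex_of_real pi * \<i>) * gauss_moment_transform f z) (at z)"
proof -
  define D where "D = (- 2 * complex_of_real pi * \<i>) * gauss_moment_transform f z"
  define K where "K = 4 * pi\<^sup>2
      * (LINT t|lborel. cmod (f t) * gauss_majorant (2 * pi * \<bar>Im z\<bar> + 2 * pi) t)"
  have "((\<lambda>y. (gauss_transform f y - gauss_transform f z) / (y - z) - D) \<longlongrightarrow> 0) (at z)"
  proof (rule Lim_null_comparison)
    show "\<forall>\<^sub>F y in at z. norm ((gauss_transform f y - gauss_transform f z) / (y - z) - D)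
        \<le> K * norm (y - z)"
      unfolding eventually_at D_def K_def
      using gauss_transform_difference_quotient_bound[OF f]
      by (intro exI[of _ 1]) (auto simp: dist_norm)
    have "((\<lambda>y. K * norm (y - z)) \<longlongrightarrow> K * norm (z - z)) (at z)"
      by (intro tendsto_intros)
    then show "((\<lambda>y. K * norm (y - z)) \<longlongrightarrow> 0) (at z)" by simp
  qed
  then show ?thesis
    unfolding D_def[symmetric] by (simp add: has_field_derivative_iff LIM_zero_iff)
qed

lemma gauss_transform_holomorphic: "f \<in> L2 \<Longrightarrow> gauss_transform f holomorphic_on UNIV"
  using gauss_transform_has_field_derivative by (auto simp: holomorphic_on_open)

lemma deriv_gauss_transform:
  "f \<in> L2 \<Longrightarrow> deriv (gauss_transform f) z = (- 2 * complex_of_real pi * \<i>) * gauss_moment_transform f z"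
  using gauss_transform_has_field_derivative DERIV_imp_deriv by blast

section \<open>Injectivity of the Fourier transform on \<open>L\<^sup>1\<close>\<close>

lemma integrable_mult_cis:
  fixes g :: "real \<Rightarrow> complex"
  assumes "integrable lborel g"
  shows "integrable lborel (\<lambda>x. g x * cis (- 2 * pi * x * \<xi>))"
proof (rule Bochner_Integration.integrable_bound[OF integrable_norm[OF assms]])
  have "(\<lambda>x. cis (- 2 * pi * x * \<xi>)) \<in> borel_measurable borel"
    by (intro borel_measurable_continuous_onI continuous_intros)
  then show "(\<lambda>x. g x * cis (- 2 * pi * x * \<xi>)) \<in> borel_measurable lborel"
    using borel_measurable_integrable[OF assms] by measurable
qed (auto simp: norm_mult)

lemma fourier_linear:
  assumes "integrable lborel f" and "integrable lborel g"
  shows "fourier (\<lambda>x. a * f x + b * g x) \<xi> = a * fourier f \<xi> + b * fourier g \<xi>"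
proof -
  have "fourier (\<lambda>x. a * f x + b * g x) \<xi>
      = (LINT x|lborel. a * (f x * cis (- 2 * pi * x * \<xi>)) + b * (g x * cis (- 2 * pi * x * \<xi>)))"
    unfolding fourier_def by (simp add: algebra_simps)
  also have "\<dots> = a * fourier f \<xi> + b * fourier g \<xi>"
    unfolding fourier_def using integrable_mult_cis[OF assms(1)] integrable_mult_cis[OF assms(2)]
    by simp
  finally show ?thesis .
qed

lemma fourier_cnj: "fourier (\<lambda>x. cnj (g x)) \<xi> = cnj (fourier g (- \<xi>))"
proof -
  have "fourier (\<lambda>x. cnj (g x)) \<xi> = (LINT x|lborel. cnj (g x * cis (- 2 * pi * x * (- \<xi>))))"
    unfolding fourier_def by (rule Bochner_Integration.integral_cong) (simp_all add: cis_cnj)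
  then show ?thesis by (simp only: Bochner_Integration.integral_cnj fourier_def)
qed

lemma fourier_at_0: "fourier g 0 = (LINT x|lborel. g x)"
  by (simp add: fourier_def)

lemma integral_mult_iexp_eq_fourier:
  "(CLINT x|lborel. g x * iexp (t * x)) = fourier g (- t / (2 * pi))"
  unfolding fourier_def
  by (rule Bochner_Integration.integral_cong) (auto simp: cis_conv_exp mult.commute)

lemma real_distribution_density:
  fixes g :: "real \<Rightarrow> real"
  assumes "g \<in> borel_measurable borel" and "\<And>x. g x \<ge> 0"
    and "integrable lborel g" and "(LINT x|lborel. g x) = 1"
  shows "real_distribution (density lborel (\<lambda>x. ennreal (g x)))"
proof -
  have "emeasure (density lborel (\<lambda>x. ennreal (g x))) UNIV = (\<integral>\<^sup>+ x. ennreal (g x) \<partial>lborel)"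
    using assms(1) by (simp add: emeasure_density)
  also have "\<dots> = ennreal (LINT x|lborel. g x)"
    using assms(2,3) by (intro nn_integral_eq_integral) auto
  finally show ?thesis
    unfolding real_distribution_def real_distribution_axioms_def
    using assms(4) by (auto intro!: prob_spaceI)
qed

lemma char_density_eq_fourier:
  fixes g :: "real \<Rightarrow> real"
  assumes "g \<in> borel_measurable borel" and "\<And>x. g x \<ge> 0"
  shows "char (density lborel (\<lambda>x. ennreal (g x))) t
    = fourier (\<lambda>x. complex_of_real (g x)) (- t / (2 * pi))"
  unfolding char_def integral_mult_iexp_eq_fourier[symmetric] using assms
  by (subst integral_density) (auto simp: scaleR_conv_of_real)

text \<open>After normalising to unit mass, \<open>u\<close> and \<open>v\<close> are densities of probability measures with
  the same characteristic function; Levy's uniqueness theorem identifies the measures.\<close>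
lemma AE_eq_if_fourier_eq_nonneg:
  fixes u v :: "real \<Rightarrow> real"
  assumes u: "integrable lborel u" "\<And>x. u x \<ge> 0"
    and v: "integrable lborel v" "\<And>x. v x \<ge> 0"
    and eq: "\<And>\<xi>. fourier (\<lambda>x. complex_of_real (u x)) \<xi> = fourier (\<lambda>x. complex_of_real (v x)) \<xi>"
  shows "AE x in lborel. u x = v x"
proof -
  have [measurable]: "u \<in> borel_measurable borel" "v \<in> borel_measurable borel"
    using u(1) v(1) by (simp_all add: borel_measurable_integrable)
  define m where "m = (LINT x|lborel. u x)"
  have mass_eq: "(LINT x|lborel. v x) = m"
    using eq[of 0] by (simp add: m_def fourier_at_0)
  have "m \<ge> 0" unfolding m_def using u(2) by simp
  show ?thesis
  proof (cases "m = 0")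
    case True
    have "(LINT x|lborel. u x) = 0" "(LINT x|lborel. v x) = 0"
      using True mass_eq by (simp_all add: m_def)
    then have "AE x in lborel. u x = 0" "AE x in lborel. v x = 0"
      using u v by (simp_all add: integral_nonneg_eq_0_iff_AE)
    then show ?thesis by eventually_elim simp
  next
    case False
    with \<open>m \<ge> 0\<close> have "m > 0" by simp
    define Mu where "Mu = density lborel (\<lambda>x. ennreal (u x / m))"
    define Mv where "Mv = density lborel (\<lambda>x. ennreal (v x / m))"
    have "real_distribution Mu" "real_distribution Mv"
      unfolding Mu_def Mv_def using u v \<open>m > 0\<close> mass_eq
      by (auto intro!: real_distribution_density simp: m_def)
    moreover have "char Mu = char Mv"
    proof
      fix t
      show "char Mu t = char Mv t"
        unfolding Mu_def Mv_def using u(2) v(2) \<open>m > 0\<close> eq[of "- t / (2 * pi)"]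
        by (simp add: char_density_eq_fourier fourier_def)
    qed
    ultimately have "Mu = Mv" by (rule Levy_uniqueness)
    moreover have "(\<integral>\<^sup>+ x. ennreal (u x / m) \<partial>lborel) \<noteq> \<top>"
      using u \<open>m > 0\<close> by (subst nn_integral_eq_integral) auto
    ultimately have "AE x in lborel. u x / m = v x / m"
      unfolding Mu_def Mv_def using u(2) v(2) \<open>m > 0\<close>
      by (subst (asm) finite_density_unique) (auto simp: ennreal_inj)
    then show ?thesis by eventually_elim (use \<open>m > 0\<close> in auto)
  qed
qed

lemma fourier_injective_real:
  fixes u :: "real \<Rightarrow> real"
  assumes "integrable lborel u" and "\<And>\<xi>. fourier (\<lambda>x. complex_of_real (u x)) \<xi> = 0"
  shows "AE x in lborel. u x = 0"
proof -
  define up where "up x = max (u x) 0" for x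
  define um where "um x = max (- u x) 0" for x
  have up: "integrable lborel up" "\<And>x. up x \<ge> 0" and um: "integrable lborel um" "\<And>x. um x \<ge> 0"
    unfolding up_def um_def using assms(1) by auto
  have u_split: "(\<lambda>x. complex_of_real (u x))
      = (\<lambda>x. 1 * complex_of_real (up x) + (- 1) * complex_of_real (um x))"
    by (simp add: fun_eq_iff up_def um_def max_def)
  have "fourier (\<lambda>x. 1 * complex_of_real (up x) + (- 1) * complex_of_real (um x)) \<xi>
      = 1 * fourier (\<lambda>x. complex_of_real (up x)) \<xi> + (- 1) * fourier (\<lambda>x. complex_of_real (um x)) \<xi>"
    for \<xi> using up(1) um(1) by (intro fourier_linear) auto
  then have "fourier (\<lambda>x. complex_of_real (u x)) \<xi>
      = fourier (\<lambda>x. complex_of_real (up x)) \<xi> - fourier (\<lambda>x. complex_of_real (um x)) \<xi>" for \<xi>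
    by (simp only: u_split) simp
  then have "AE x in lborel. up x = um x"
    using assms(2) by (intro AE_eq_if_fourier_eq_nonneg up um) simp
  then show ?thesis by eventually_elim (auto simp: up_def um_def)
qed

lemma fourier_injective:
  fixes g :: "real \<Rightarrow> complex"
  assumes g: "integrable lborel g" and F: "\<And>\<xi>. fourier g \<xi> = 0"
  shows "AE x in lborel. g x = 0"
proof -
  have gc: "integrable lborel (\<lambda>x. cnj (g x))" using g by simp
  have "fourier (\<lambda>x. cnj (g x)) \<xi> = 0" for \<xi>
    using F[of "- \<xi>"] by (simp add: fourier_cnj)
  then have zero: "fourier (\<lambda>x. a * g x + b * cnj (g x)) \<xi> = 0" for a b \<xi>
    by (simp add: fourier_linear[OF g gc] F)
  have "(\<lambda>x. complex_of_real (Re (g x))) = (\<lambda>x. 1 / 2 * g x + 1 / 2 * cnj (g x))"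
    by (simp add: fun_eq_iff complex_eq_iff)
  then have "fourier (\<lambda>x. complex_of_real (Re (g x))) \<xi> = 0" for \<xi>
    by (simp only: zero)
  then have "AE x in lborel. Re (g x) = 0"
    using g by (intro fourier_injective_real) auto
  moreover have "(\<lambda>x. complex_of_real (Im (g x))) = (\<lambda>x. - \<i> / 2 * g x + \<i> / 2 * cnj (g x))"
    by (simp add: fun_eq_iff complex_eq_iff)
  then have "fourier (\<lambda>x. complex_of_real (Im (g x))) \<xi> = 0" for \<xi>
    by (simp only: zero)
  then have "AE x in lborel. Im (g x) = 0"
    using g by (intro fourier_injective_real) auto
  ultimately show ?thesis by eventually_elim (simp add: complex_eq_iff)
qed

section \<open>The transform on the real line\<close>

lemma gauss_kernel_of_real: "gauss_kernel (complex_of_real \<xi>) t = gamma1 t * cis (- 2 * pi * t * \<xi>)"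
proof -
  have "gauss_kernel (complex_of_real \<xi>) t
      = exp (complex_of_real (- pi * t\<^sup>2) + \<i> * complex_of_real (- 2 * pi * t * \<xi>))"
    unfolding gauss_kernel_def by (rule arg_cong[where f = exp]) (simp add: algebra_simps)
  also have "\<dots> = gamma1 t * cis (- 2 * pi * t * \<xi>)"
    by (simp only: exp_add gamma1_def cis_conv_exp exp_of_real)
  finally show ?thesis .
qed

lemma fourier_gamma1_mult: "fourier (\<lambda>t. gamma1 t * f t) \<xi> = gauss_transform f \<xi>"
  unfolding fourier_def gauss_transform_def
  by (rule Bochner_Integration.integral_cong) (simp_all add: gauss_kernel_of_real)

lemma fourier_gamma2_mult:
  assumes "f \<in> L2"
  shows "fourier (\<lambda>t. gamma2 t * f t) \<xi> = \<i> * deriv (gauss_transform f) \<xi>"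
proof -
  have "fourier (\<lambda>t. gamma2 t * f t) \<xi> = (LINT t|lborel.
      2 * complex_of_real pi * (complex_of_real t * f t * gauss_kernel (complex_of_real \<xi>) t))"
    unfolding fourier_def
    by (rule Bochner_Integration.integral_cong)
       (simp_all add: gauss_kernel_of_real gamma2_def gamma1_def)
  also have "\<dots> = 2 * complex_of_real pi * gauss_moment_transform f \<xi>"
    unfolding gauss_moment_transform_def by (rule integral_mult_right_zero)
  also have "\<dots> = \<i> * deriv (gauss_transform f) \<xi>"
    unfolding deriv_gauss_transform[OF assms] by (simp add: algebra_simps)
  finally show ?thesis .
qed

lemma gamma1_mult_integrable:
  assumes f: "f \<in> L2"
  shows "integrable lborel (\<lambda>t. gamma1 t * f t)"
proof (rule Bochner_Integration.integrable_bound[OF L2_mult_gauss_majorant_integrable[OF f, of 0]])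
  have "f \<in> borel_measurable lborel" using f by (simp add: L2_def)
  then show "(\<lambda>t. gamma1 t * f t) \<in> borel_measurable lborel"
    unfolding gamma1_def by measurable
  show "AE x in lborel. norm (gamma1 x * f x) \<le> norm (cmod (f x) * gauss_majorant 0 x)"
  proof (rule AE_I2)
    fix x
    have "exp (- pi * x\<^sup>2) \<le> gauss_majorant 0 x"
      unfolding gauss_majorant_def by (simp add: mult_le_cancel_right1)
    then have "cmod (f x) * exp (- pi * x\<^sup>2) \<le> cmod (f x) * gauss_majorant 0 x"
      by (rule mult_left_mono) simp
    then show "norm (gamma1 x * f x) \<le> norm (cmod (f x) * gauss_majorant 0 x)"
      using gauss_majorant_nonneg[of 0 x] by (simp add: gamma1_def norm_mult mult.commute)
  qed
qed

lemma L2_reflect: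
  assumes "f \<in> L2"
  shows "(\<lambda>x. cnj (f (- x))) \<in> L2"
proof -
  have "f \<in> borel_measurable borel"
    and square_integrable: "integrable lborel (\<lambda>x. (cmod (f x))\<^sup>2)"
    using assms by (auto simp: L2_def)
  have "integrable lborel (\<lambda>x. (cmod (f (0 + (- 1) * x)))\<^sup>2)"
    by (rule lborel_integrable_real_affine[OF square_integrable]) simp
  moreover have "(\<lambda>x. cnj (f (- x))) \<in> borel_measurable borel"
    using \<open>f \<in> borel_measurable borel\<close>
    by (intro measurable_compose[OF _ borel_measurable_continuous_onI[OF continuous_on_cnj]]
        measurable_compose[OF borel_measurable_uminus]) auto
  ultimately show ?thesis by (simp add: L2_def)
qed

lemma gauss_transform_reflect:
  "gauss_transform (\<lambda>x. cnj (f (- x))) (complex_of_real \<xi>) = cnj (gauss_transform f (complex_of_real \<xi>))"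
proof -
  have "cnj (gauss_transform f \<xi>) = (LINT t|lborel. cnj (f t * gauss_kernel \<xi> t))"
    unfolding gauss_transform_def by (rule Bochner_Integration.integral_cnj[symmetric])
  also have "\<dots> = (LINT t|lborel. cnj (f t) * gauss_kernel \<xi> (- t))"
    by (rule Bochner_Integration.integral_cong) (auto simp: gauss_kernel_def exp_cnj)
  also have "\<dots> = (LINT t|lborel. cnj (f (- t)) * gauss_kernel \<xi> t)"
    by (subst lborel_integral_real_affine[where c = "- 1" and t = 0]) auto
  finally show ?thesis by (simp add: gauss_transform_def)
qed

lemma AE_eq_if_gauss_transform_eq:
  assumes f: "f \<in> L2" and g: "g \<in> L2"
    and eq: "\<And>\<xi>::real. gauss_transform g \<xi> = c * gauss_transform f \<xi>"
  shows "AE x in lborel. g x = c * f x"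
proof -
  have "fourier (\<lambda>t. 1 * (gamma1 t * g t) + (- c) * (gamma1 t * f t)) \<xi>
      = gauss_transform g \<xi> - c * gauss_transform f \<xi>" for \<xi>
    by (subst fourier_linear) (simp_all add: gamma1_mult_integrable f g fourier_gamma1_mult)
  then have "AE x in lborel. 1 * (gamma1 x * g x) + (- c) * (gamma1 x * f x) = 0"
    using f g eq
    by (intro fourier_injective)
       (auto intro!: Bochner_Integration.integrable_diff Bochner_Integration.integrable_mult_right
         gamma1_mult_integrable)
  then show ?thesis
  proof eventually_elim
    case (elim x)
    then have "gamma1 x * (g x - c * f x) = 0" by (simp add: algebra_simps)
    then show ?case by (simp add: gamma1_def)
  qed
qed

theorem mainTheorem1:
  fixes \<phi> \<psi> :: "real \<Rightarrow> complex"
  assumes "\<phi> \<in> L2" and "\<psi> \<in> L2"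
    and "\<And>\<xi>. cmod (fourier (\<lambda>t. gamma1 t * \<phi> t) \<xi>) = cmod (fourier (\<lambda>t. gamma1 t * \<psi> t) \<xi>)"
    and "\<And>\<xi>. cmod (fourier (\<lambda>t. gamma2 t * \<phi> t) \<xi>) = cmod (fourier (\<lambda>t. gamma2 t * \<psi> t) \<xi>)"
  shows "\<exists>c::complex. cmod c = 1 \<and>
           ((AE x in lborel. \<psi> x = c * \<phi> x) \<or> (AE x in lborel. \<psi> x = c * cnj (\<phi> (- x))))"
proof -
  have "cmod (gauss_transform \<phi> x) = cmod (gauss_transform \<psi> x)" for x :: real
    using assms(3)[of x] by (simp add: fourier_gamma1_mult)
  moreover have "cmod (deriv (gauss_transform \<phi>) x) = cmod (deriv (gauss_transform \<psi>) x)" for x :: real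
    using assms(4)[of x] by (simp add: fourier_gamma2_mult assms(1,2) norm_mult)
  ultimately obtain c where "cmod c = 1"
    and "(\<forall>z. gauss_transform \<psi> z = c * gauss_transform \<phi> z)
       \<or> (\<forall>z. gauss_transform \<psi> z = c * cnj (gauss_transform \<phi> (cnj z)))"
    using entire_phase_retrieval[OF gauss_transform_holomorphic[OF assms(1)]
        gauss_transform_holomorphic[OF assms(2)]] by blast
  then show ?thesis
    using AE_eq_if_gauss_transform_eq[OF assms(1,2), of c]
      AE_eq_if_gauss_transform_eq[OF L2_reflect[OF assms(1)] assms(2), of c]
    by (auto simp: gauss_transform_reflect)
qed

end
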